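(* For all positive integers $r$ and $s$, $$\mathrm{CR}(r,s)\leq r\,2^{(2r+1)2^{s-1}-2}.$$
   Context: Let $[n]=\{1,2,\ldots,n\}$ and let $2^{[n]}$ denote the power set of $[n]$. A collection $\mathcal{B}\subseteq 2^{[n]}$ forms a $d$-dimensional Boolean algebra (a copy of $\mathcal{B}_d$) if there exist pairwise disjoint sets $X_0,X_1,\ldots,X_d\subseteq[n]$, all non-empty with perhaps the exception of $X_0$, such that $\mathcal{B}=\{X_0\cup\bigcup_{i\in I}X_i : I\subseteq[d]\}$. A coloring of $2^{[n]}$ assigns a color to each subset of $[n]$, with no restriction on the number of colors. A copy of $\mathcal{B}_d$ is rainbow if all its member sets receive distinct colors, and monochromatic if all its member sets receive the same color. Let $\mathrm{CR}(r,s)$ be the minimum $n$ such that every coloring of $2^{[n]}$ contains a rainbow copy of $\mathcal{B}_r$ or a monochromatic copy of $\mathcal{B}_s$. *)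

theory Defs
  imports Main "HOL-Library.Disjoint_Sets" "HOL-Library.Extended_Nat"
begin

definition boolean_algebra_copy :: "nat \<Rightarrow> nat \<Rightarrow> nat set set \<Rightarrow> bool" where
  "boolean_algebra_copy n d B \<longleftrightarrow>
     (\<exists>X :: nat \<Rightarrow> nat set.
        (\<forall>i\<in>{0..d}. X i \<subseteq> {1..n}) \<and>
        disjoint_family_on X {0..d} \<and>
        (\<forall>i\<in>{1..d}. X i \<noteq> {}) \<and>
        B = {X 0 \<union> (\<Union>i\<in>I. X i) | I. I \<subseteq> {1..d}})"

definition rainbow :: "(nat set \<Rightarrow> 'c) \<Rightarrow> nat set set \<Rightarrow> bool" where
  "rainbow c B \<longleftrightarrow> inj_on c B"

definition monochromatic :: "(nat set \<Rightarrow> 'c) \<Rightarrow> nat set set \<Rightarrow> bool" where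
  "monochromatic c B \<longleftrightarrow> (\<exists>k. \<forall>A\<in>B. c A = k)"

(* Colors are natural numbers: only finitely many sets are colored, so this does not
   restrict the number of colors. Values of c outside Pow {1..n} play no role. *)
definition CR_property :: "nat \<Rightarrow> nat \<Rightarrow> nat \<Rightarrow> bool" where
  "CR_property r s n \<longleftrightarrow>
     (\<forall>c :: nat set \<Rightarrow> nat.
        (\<exists>B. boolean_algebra_copy n r B \<and> rainbow c B) \<or>
        (\<exists>B. boolean_algebra_copy n s B \<and> monochromatic c B))"

(* The minimum is taken in the extended naturals, so that it would be infinite if no n
   had the property; an upper bound therefore includes the existence of such an n. *)
definition CR :: "nat \<Rightarrow> nat \<Rightarrow> enat" where
  "CR r s = Inf {enat n | n. CR_property r s n}"

end

theory Submission
  imports Defs "HOL-Combinatorics.Multiset_Permutations" "HOL-Library.FuncSet" Complex_Main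
begin

text \<open>
  Suppose that a coloring has no monochromatic copy of dimension \<open>s\<close>. The proof makes a random choice
  of a copy of dimension \<open>r\<close> and shows that, with positive probability, no two of its \<open>2 ^ r\<close> members
  get the same color.

  The ground set consists of \<open>r\<close> blocks of equal size \<open>m\<close>, and \<open>X\<^sub>i\<close> is a random non-empty subset of the
  \<open>i\<close>-th block: the member of a uniformly random maximal chain on a uniformly random level from 1 to
  \<open>m\<close>. Two members with index
  sets \<open>I \<noteq> J\<close> differ in a coordinate \<open>i\<close> that enters only one of them, say \<open>i \<in> I - J\<close>. With all other
  coordinates fixed, the two members agree in color only if \<open>X\<^sub>i\<close> falls into a family \<open>F\<close> of subsets of
  the block that is monochromatic after adding a fixed set outside the block. By a union bound over
  fewer than \<open>2 ^ (2 * r - 1)\<close> pairs (\<open>exists_choice_avoiding_rare_events\<close>), it is enough that such an \<open>F\<close>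
  has probability at most \<open>2 ^ - (2 * r - 1)\<close>.

  Now \<open>F\<close> contains no cube of dimension \<open>s\<close>, since this would give a monochromatic copy. The
  density theorem \<open>lubell_large_imp_contains_cube\<close> says that the expected number \<open>L\<close> of members of such
  a family on a random maximal chain is at most \<open>(4 * m) powr (1 - 2 powr - (s - 1))\<close>. Its proof is an
  induction in the style of Hilbert's cube lemma: by convexity, a random chain contains on average at
  least \<open>L * (L - 1) / 2\<close> nested pairs of members (\<open>lubell_second_moment\<close>), so some set \<open>D\<close> is the
  difference of so many pairs that the family of their smaller members is again dense, now as a
  family of subsets of the complement of \<open>D\<close>, and \<open>D\<close> becomes a new direction of the cube.

  The probability of \<open>F\<close> is \<open>L / m\<close>, hence at most \<open>4 * (4 * m) powr - (2 powr - (s - 1))\<close>. For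
  \<open>4 * m = 2 ^ ((2 * r + 1) * 2 ^ (s - 1))\<close> this is exactly \<open>2 ^ - (2 * r - 1)\<close>, and \<open>r * m\<close> is the bound
  of the theorem.
\<close>

section \<open>Lubell masses and random maximal chains\<close>

text \<open>
  If a maximal chain of \<open>Pow V\<close> is chosen uniformly at random, it passes through a given set
  \<open>A\<close> with probability \<open>1 / (card V choose card A)\<close>. So this is the expected number of members of
  \<open>F\<close> on a random maximal chain.\<close>

definition lubell :: "'a set \<Rightarrow> 'a set set \<Rightarrow> real" where
  "lubell V F = (\<Sum>A\<in>F. 1 / real (card V choose card A))"

text \<open>
  An ordering of \<open>V\<close> encodes the maximal chain of the sets of its initial segments.\<close>

definition passes :: "'a list \<Rightarrow> 'a set \<Rightarrow> bool" where
  "passes xs A \<longleftrightarrow> set (take (card A) xs) = A"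

text \<open>
  A cube in this family, together with \<open>D\<close> as a new direction, spans a cube in \<open>F\<close> of one dimension
  more.\<close>

definition translates_into :: "'a set set \<Rightarrow> 'a set \<Rightarrow> 'a set set" where
  "translates_into F D = {A \<in> F. A \<inter> D = {} \<and> A \<union> D \<in> F}"

text \<open>
  Every maximal chain has exactly one member on each of the levels from 1 to \<open>card V\<close>. Dividing by
  \<open>card V\<close> makes the weights a probability distribution on the non-empty subsets, which is how they
  serve in the choice of the rainbow copy.\<close>

lemma sum_inverse_binomial_nonempty_subsets:
  assumes "finite V"
  shows "(\<Sum>A\<in>Pow V - {{}}. 1 / real (card V choose card A)) = real (card V)"
proof -
  have "(\<Sum>A\<in>Pow V - {{}}. 1 / real (card V choose card A))
      = (\<Sum>k\<in>{1..card V}. \<Sum>A\<in>{A \<in> Pow V - {{}}. card A = k}. 1 / real (card V choose card A))"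
    by (rule sum.group[symmetric])
       (use assms in \<open>auto simp: card_mono card_gt_0_iff Suc_le_eq dest: finite_subset[OF _ assms]\<close>)
  also have "\<dots> = (\<Sum>k\<in>{1..card V}. 1)"
  proof (rule sum.cong[OF refl])
    fix k assume k: "k \<in> {1..card V}"
    have "{A \<in> Pow V - {{}}. card A = k} = {A. A \<subseteq> V \<and> card A = k}"
      using k by auto
    then have "(\<Sum>A\<in>{A \<in> Pow V - {{}}. card A = k}. 1 / real (card V choose card A))
        = (\<Sum>A\<in>{A. A \<subseteq> V \<and> card A = k}. 1 / real (card V choose k))"
      by (intro sum.cong) auto
    also have "\<dots> = 1"
      using k by (simp add: n_subsets[OF assms])
    finally show "(\<Sum>A\<in>{A \<in> Pow V - {{}}. card A = k}. 1 / real (card V choose card A)) = 1" .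
  qed
  finally show ?thesis by simp
qed

text \<open>
  Such an ordering is an ordering of \<open>A\<close>, followed by one of \<open>B - A\<close> and one of \<open>V - B\<close>.\<close>

lemma card_permutations_through_nested_pair:
  assumes "finite V" "A \<subseteq> B" "B \<subseteq> V"
  shows "card {xs \<in> permutations_of_set V. passes xs A \<and> passes xs B}
       = fact (card A) * fact (card (B - A)) * fact (card (V - B))"
proof -
  let ?S = "permutations_of_set A \<times> permutations_of_set (B - A) \<times> permutations_of_set (V - B)"
  let ?f = "\<lambda>(x, y, z). x @ y @ z :: 'a list"
  have fin: "finite A" "finite B"
    using assms by (auto intro: finite_subset)
  have len: "length x = card A" if "x \<in> permutations_of_set A" for x and A :: "'a set"
    using that by (simp add: length_finite_permutations_of_set)
  have cB: "card A + card (B - A) = card B"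
    using card_mono[OF fin(2) assms(2)] by (simp add: card_Diff_subset fin assms(2))
  have "{xs \<in> permutations_of_set V. passes xs A \<and> passes xs B} = ?f ` ?S"
  proof (intro equalityI subsetI)
    fix xs assume "xs \<in> {xs \<in> permutations_of_set V. passes xs A \<and> passes xs B}"
    then have xs: "set xs = V" "distinct xs" and A: "set (take (card A) xs) = A"
      and B: "set (take (card B) xs) = B"
      by (auto simp: passes_def permutations_of_set_def)
    define x y z where "x = take (card A) xs" and "y = drop (card A) (take (card B) xs)"
      and "z = drop (card B) xs"
    have xy: "take (card B) xs = x @ y"
      using cB unfolding x_def y_def
      by (metis append_take_drop_id le_add1 min.absorb1 take_take)
    have eq: "xs = x @ y @ z"
      using xy unfolding z_def by (metis append.assoc append_take_drop_id)
    have "set x = A" "set (x @ y) = B"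
      using A B xy x_def by simp_all
    then have "(x, y, z) \<in> ?S"
      using xs eq by (auto simp: permutations_of_set_def)
    with eq show "xs \<in> ?f ` ?S" by force
  next
    fix xs assume "xs \<in> ?f ` ?S"
    then obtain x y z where xs: "xs = x @ y @ z" and x: "x \<in> permutations_of_set A"
      and y: "y \<in> permutations_of_set (B - A)" and z: "z \<in> permutations_of_set (V - B)"
      by auto
    have "length (x @ y) = card B"
      using len[OF x] len[OF y] cB by simp
    then have "take (card A) xs = x" "take (card B) xs = x @ y"
      using len[OF x] unfolding xs by (simp_all add: append_assoc[symmetric] del: append_assoc)
    then show "xs \<in> {xs \<in> permutations_of_set V. passes xs A \<and> passes xs B}"
      using x y z xs assms by (auto simp: passes_def permutations_of_set_def)
  qed
  moreover have "inj_on ?f ?S"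
    by (auto simp: inj_on_def dest!: len)
  ultimately show ?thesis
    using assms fin by (simp add: card_image card_cartesian_product)
qed

lemma card_permutations_through:
  assumes "finite V" "A \<subseteq> V"
  shows "real (card {xs \<in> permutations_of_set V. passes xs A})
       = fact (card V) / real (card V choose card A)"
proof -
  have "card (V - A) = card V - card A"
    using assms by (simp add: card_Diff_subset finite_subset)
  moreover have "card A \<le> card V"
    using assms by (rule card_mono)
  ultimately show ?thesis
    using card_permutations_through_nested_pair[of V A A] assms
    by (simp add: binomial_fact)
qed

lemma passes_imp_nested:
  assumes "passes xs A" "passes xs B"
  shows "A \<subseteq> B \<or> B \<subseteq> A"
  using assms set_take_subset_set_take unfolding passes_def
  by (metis nat_le_linear)

text \<open>
  Let \<open>k\<close> be the number of members of \<open>F\<close> on a random maximal chain and \<open>L\<close> its expectation. The left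
  side is \<open>L\<^sup>2 - L\<close>, which is at most the expectation of \<open>k\<^sup>2 - k\<close>, and \<open>k\<^sup>2 - k\<close> counts the nested
  pairs \<open>A \<subset> B\<close> of members on the chain twice. The right side is this count again, with the pairs
  sorted by their difference \<open>D = B - A\<close>: a chain passes through both \<open>A\<close> and \<open>A \<union> D\<close> with probability
  \<open>1 / ((card (V - D) choose card A) * (card V choose card D))\<close>, because \<open>D\<close> is equally likely to be any set
  of its size, and deleting it leaves a uniformly random chain of \<open>V - D\<close>.\<close>

lemma lubell_second_moment:
  assumes V: "finite V" and F: "F \<subseteq> Pow V"
  shows "lubell V F * (lubell V F - 1)
       \<le> 2 * (\<Sum>D\<in>Pow V - {{}}. lubell (V - D) (translates_into F D) / real (card V choose card D))"
proof -
  let ?P = "permutations_of_set V"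
  let ?L = "lubell V F"
  define N where "N = (\<lambda>A B. real (card {xs \<in> ?P. passes xs A \<and> passes xs B}))"
  define k where "k = (\<lambda>xs. \<Sum>A\<in>F. of_bool (passes xs A) :: real)"
  have finF: "finite F"
    using V F by (auto intro: finite_subset)
  have N_eq: "N A B = (\<Sum>xs\<in>?P. of_bool (passes xs A) * of_bool (passes xs B))" for A B
    unfolding N_def by (simp add: sum_of_bool_eq Int_def flip: of_bool_conj)
  have k1: "(\<Sum>xs\<in>?P. k xs) = fact (card V) * ?L"
  proof -
    have "(\<Sum>xs\<in>?P. k xs) = (\<Sum>A\<in>F. N A A)"
      unfolding k_def N_eq by (subst sum.swap) (simp flip: of_bool_conj)
    also have "\<dots> = (\<Sum>A\<in>F. fact (card V) / real (card V choose card A))"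
      using F V by (intro sum.cong) (auto simp: N_def card_permutations_through)
    finally show ?thesis
      by (simp add: lubell_def sum_distrib_left)
  qed
  have diag: "(\<Sum>A\<in>F. N A A) = fact (card V) * ?L"
    using k1 unfolding k_def N_eq by (subst (asm) sum.swap) (simp flip: of_bool_conj)
  have k2: "(\<Sum>xs\<in>?P. (k xs)\<^sup>2) = (\<Sum>A\<in>F. \<Sum>B\<in>F. N A B)"
  proof -
    have "(\<Sum>xs\<in>?P. (k xs)\<^sup>2) = (\<Sum>xs\<in>?P. \<Sum>A\<in>F. \<Sum>B\<in>F. of_bool (passes xs A) * of_bool (passes xs B))"
      unfolding k_def power2_eq_square sum_product ..
    also have "\<dots> = (\<Sum>A\<in>F. \<Sum>xs\<in>?P. \<Sum>B\<in>F. of_bool (passes xs A) * of_bool (passes xs B))"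
      by (rule sum.swap)
    also have "\<dots> = (\<Sum>A\<in>F. \<Sum>B\<in>F. N A B)"
      unfolding N_eq by (intro sum.cong refl sum.swap)
    finally show ?thesis .
  qed
  have cardP: "real (card ?P) = fact (card V)"
    using V by simp
  \<comment> \<open>The tangent to the parabola at the mean bounds the second moment from below.\<close>
  have "(\<Sum>xs\<in>?P. 2 * ?L * k xs - ?L\<^sup>2) \<le> (\<Sum>xs\<in>?P. (k xs)\<^sup>2)"
  proof (rule sum_mono)
    fix xs
    have "0 \<le> (k xs - ?L)\<^sup>2" by simp
    then show "2 * ?L * k xs - ?L\<^sup>2 \<le> (k xs)\<^sup>2"
      by (simp add: power2_diff algebra_simps)
  qed
  moreover have "(\<Sum>xs\<in>?P. 2 * ?L * k xs - ?L\<^sup>2) = fact (card V) * ?L\<^sup>2"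
    unfolding sum_subtractf sum_distrib_left[symmetric] k1 sum_constant cardP
    by (simp add: power2_eq_square algebra_simps)
  ultimately have lower: "fact (card V) * ?L\<^sup>2 \<le> (\<Sum>A\<in>F. \<Sum>B\<in>F. N A B)"
    using k2 by simp
  have split: "(\<Sum>A\<in>F. \<Sum>B\<in>F. N A B) = (\<Sum>A\<in>F. N A A) + 2 * (\<Sum>(A, B)\<in>{(A, B) \<in> F \<times> F. A \<subset> B}. N A B)"
  proof -
    let ?E = "{(A, B) \<in> F \<times> F. A = B}" and ?U = "{(A, B) \<in> F \<times> F. A \<subset> B}"
      and ?W = "{(A, B) \<in> F \<times> F. B \<subset> A}"
    have fin: "finite ?E" "finite ?U" "finite ?W"
      using finF by (auto intro: finite_subset[of _ "F \<times> F"])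
    have "(\<Sum>A\<in>F. \<Sum>B\<in>F. N A B) = (\<Sum>(A, B)\<in>F \<times> F. N A B)"
      by (simp add: sum.cartesian_product)
    also have "\<dots> = (\<Sum>(A, B)\<in>?E \<union> (?U \<union> ?W). N A B)"
    proof (rule sum.mono_neutral_right)
      show "\<forall>p\<in>F \<times> F - (?E \<union> (?U \<union> ?W)). (case p of (A, B) \<Rightarrow> N A B) = 0"
        using passes_imp_nested by (force simp: N_def)
    qed (use finF in auto)
    also have "\<dots> = (\<Sum>(A, B)\<in>?E. N A B) + ((\<Sum>(A, B)\<in>?U. N A B) + (\<Sum>(A, B)\<in>?W. N A B))"
      using fin by (subst sum.union_disjoint; (subst sum.union_disjoint)?; auto)
    also have "(\<Sum>(A, B)\<in>?E. N A B) = (\<Sum>A\<in>F. N A A)"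
      by (rule sum.reindex_bij_witness[of _ "\<lambda>A. (A, A)" fst]) auto
    also have "(\<Sum>(A, B)\<in>?W. N A B) = (\<Sum>(A, B)\<in>?U. N A B)"
      by (rule sum.reindex_bij_witness[of _ prod.swap prod.swap]) (auto simp: N_def conj_commute)
    finally show ?thesis by simp
  qed
  have "(\<Sum>(A, B)\<in>{(A, B) \<in> F \<times> F. A \<subset> B}. N A B)
      = (\<Sum>(D, A)\<in>(SIGMA D:Pow V - {{}}. translates_into F D). N A (A \<union> D))"
    by (rule sum.reindex_bij_witness[of _ "\<lambda>(D, A). (A, A \<union> D)" "\<lambda>(A, B). (B - A, A)"])
       (use F in \<open>auto simp: translates_into_def Un_absorb1\<close>)
  also have "\<dots> = (\<Sum>D\<in>Pow V - {{}}. \<Sum>A\<in>translates_into F D. N A (A \<union> D))"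
    using V finF by (subst sum.Sigma) (auto simp: translates_into_def)
  also have "\<dots> = (\<Sum>D\<in>Pow V - {{}}. fact (card V) *
      (lubell (V - D) (translates_into F D) / real (card V choose card D)))"
  proof (rule sum.cong[OF refl])
    fix D assume D: "D \<in> Pow V - {{}}"
    have "N A (A \<union> D) = fact (card V) * (1 / real (card (V - D) choose card A) / real (card V choose card D))"
      if "A \<in> translates_into F D" for A
    proof -
      have A: "A \<subseteq> V" "A \<inter> D = {}"
        using that F by (auto simp: translates_into_def)
      have fin: "finite A" "finite D" "finite (V - D)"
        using A D V by (auto intro: finite_subset)
      have cD: "card D \<le> card V" and cV: "card (V - D) = card V - card D"
        using D V fin by (auto simp: card_Diff_subset intro: card_mono)
      have cA: "card A \<le> card (V - D)"
        using A by (intro card_mono fin) auto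
      have "V - (A \<union> D) = (V - D) - A" "A \<union> D - A = D"
        using A by auto
      moreover have "card ((V - D) - A) = card (V - D) - card A"
        using A fin by (intro card_Diff_subset) auto
      ultimately have "N A (A \<union> D) = fact (card A) * fact (card D) * fact (card (V - D) - card A)"
        using card_permutations_through_nested_pair[of V A "A \<union> D"] V A D
        by (simp add: N_def)
      then show ?thesis
        by (simp add: binomial_fact cA cD) (simp add: cV field_simps)
    qed
    then show "(\<Sum>A\<in>translates_into F D. N A (A \<union> D)) = fact (card V) *
      (lubell (V - D) (translates_into F D) / real (card V choose card D))"
      by (simp add: lubell_def sum_distrib_left sum_divide_distrib)
  qed
  also have "\<dots> = fact (card V) * (\<Sum>D\<in>Pow V - {{}}.
      lubell (V - D) (translates_into F D) / real (card V choose card D))" (is "_ = _ * ?R")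
    by (simp add: sum_distrib_left)
  finally have "(fact (card V) :: real) * ?L\<^sup>2 \<le> fact (card V) * (?L + 2 * ?R)"
    using lower split diag by (simp add: algebra_simps)
  then have "?L\<^sup>2 \<le> ?L + 2 * ?R"
    by simp
  then show ?thesis
    by (simp add: power2_eq_square algebra_simps)
qed

text \<open>
  The weights \<open>1 / (card V choose card D)\<close> of the non-empty differences add up to \<open>card V\<close>, so
  one difference is at least as good as the average in the second moment bound.\<close>

lemma exists_dense_translates_into:
  assumes V: "finite V" "card V \<le> M" and F: "F \<subseteq> Pow V" and L: "lubell V F > 1"
  shows "\<exists>D. D \<subseteq> V \<and> D \<noteq> {} \<and>
    lubell V F * (lubell V F - 1) \<le> 2 * real M * lubell (V - D) (translates_into F D)"
proof (rule ccontr)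
  let ?q = "lubell V F * (lubell V F - 1)"
  have q: "?q > 0" using L by simp
  assume "\<not> ?thesis"
  then have less: "2 * real M * lubell (V - D) (translates_into F D) < ?q" if "D \<in> Pow V - {{}}" for D
    using that by (auto simp: not_le)
  have "V \<noteq> {}"
  proof
    assume "V = {}"
    with lubell_second_moment[OF V(1) F] q show False by simp
  qed
  then have ne: "Pow V - {{}} \<noteq> {}" "real M > 0"
    using V by (auto simp: card_gt_0_iff)
  have "real M * ?q \<le> (\<Sum>D\<in>Pow V - {{}}. 2 * real M * lubell (V - D) (translates_into F D) * (1 / real (card V choose card D)))"
    using mult_left_mono[OF lubell_second_moment[OF V(1) F], of "real M"]
    by (simp add: sum_distrib_left mult_ac)
  also have "\<dots> < (\<Sum>D\<in>Pow V - {{}}. ?q * (1 / real (card V choose card D)))"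
    using V ne(1) by (intro sum_strict_mono mult_strict_right_mono less) (auto intro: card_mono)
  also have "\<dots> = ?q * real (card V)"
    using V sum_inverse_binomial_nonempty_subsets[OF V(1)] by (simp only: sum_distrib_left[symmetric])
  also have "\<dots> \<le> ?q * real M"
    using q V by (intro mult_left_mono) auto
  finally show False by (simp add: mult.commute)
qed

section \<open>Cubes in families of large Lubell mass\<close>

definition contains_cube :: "nat \<Rightarrow> 'a set set \<Rightarrow> bool" where
  "contains_cube d F \<longleftrightarrow> (\<exists>X. disjoint_family_on X {0..d} \<and> (\<forall>i\<in>{1..d}. X i \<noteq> {}) \<and>
     (\<forall>I\<subseteq>{1..d}. X 0 \<union> (\<Union>i\<in>I. X i) \<in> F))"

lemma contains_cube_0: "contains_cube 0 F \<longleftrightarrow> F \<noteq> {}"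
  by (auto simp: contains_cube_def disjoint_family_on_def)

lemma contains_cube_Suc:
  assumes "contains_cube d (translates_into F D)" "D \<noteq> {}"
  shows "contains_cube (Suc d) F"
proof -
  obtain X where X: "disjoint_family_on X {0..d}" "\<forall>i\<in>{1..d}. X i \<noteq> {}"
    and cube: "\<And>I. I \<subseteq> {1..d} \<Longrightarrow> X 0 \<union> (\<Union>i\<in>I. X i) \<in> translates_into F D"
    using assms unfolding contains_cube_def by blast
  define Y where "Y = X(Suc d := D)"
  have XD: "X i \<inter> D = {}" if "i \<le> d" for i
    using cube[of "{1..d}"] that by (cases i) (force simp: translates_into_def)+
  have "disjoint_family_on Y {0..Suc d}"
    unfolding disjoint_family_on_def
  proof (intro ballI impI)
    fix m n assume "m \<in> {0..Suc d}" "n \<in> {0..Suc d}" "m \<noteq> n"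
    then show "Y m \<inter> Y n = {}"
      using disjoint_family_onD[OF X(1), of m n] XD[of m] XD[of n]
      by (auto simp: Y_def le_Suc_eq)
  qed
  moreover have "\<forall>i\<in>{1..Suc d}. Y i \<noteq> {}"
    using X(2) assms(2) by (auto simp: Y_def)
  moreover have "Y 0 \<union> (\<Union>i\<in>I. Y i) \<in> F" if I: "I \<subseteq> {1..Suc d}" for I
  proof -
    let ?I = "I - {Suc d}"
    have sub: "?I \<subseteq> {1..d}"
      using I by (auto simp: le_Suc_eq)
    have YX: "Y 0 = X 0" "(\<Union>i\<in>?I. Y i) = (\<Union>i\<in>?I. X i)"
      by (auto simp: Y_def)
    show ?thesis
    proof (cases "Suc d \<in> I")
      case True
      then have "(\<Union>i\<in>I. Y i) = (\<Union>i\<in>?I. Y i) \<union> D"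
        by (auto simp: Y_def split: if_splits)
      then show ?thesis
        using cube[OF sub] by (simp add: YX Un_assoc translates_into_def)
    next
      case False
      then show ?thesis
        using cube[OF sub] YX by (simp add: translates_into_def)
    qed
  qed
  ultimately show ?thesis
    unfolding contains_cube_def by blast
qed

lemma contains_cube_mono:
  assumes "contains_cube d F" "F \<subseteq> G"
  shows "contains_cube d G"
  using assms unfolding contains_cube_def by (meson subset_iff)

text \<open>
  The induction raises the dimension by one in exchange for passing from \<open>L\<close> to \<open>L\<^sup>2 / (4 * M)\<close>: the
  averaging bound gives \<open>L * (L - 1) / (2 * M)\<close>, and \<open>L - 1 \<ge> L / 2\<close> once \<open>L \<ge> 2\<close>. The number \<open>M\<close> stays
  fixed while the ground set shrinks from \<open>V\<close> to \<open>V - D\<close>. In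
  dimension 1 the hypothesis says \<open>L > 1\<close>: some maximal chain then passes through two members.\<close>

lemma lubell_large_imp_contains_cube:
  assumes "M > 0" "finite V" "card V \<le> M" "F \<subseteq> Pow V"
    and "lubell V F ^ 2 ^ t > (4 * real M) ^ (2 ^ t - 1)"
  shows "contains_cube (Suc t) F"
  using assms(2-)
proof (induction t arbitrary: V F)
  case 0
  obtain D where D: "D \<subseteq> V" "D \<noteq> {}"
    "lubell V F * (lubell V F - 1) \<le> 2 * real M * lubell (V - D) (translates_into F D)"
    using exists_dense_translates_into[of V M F] 0 by auto
  have "0 < lubell V F * (lubell V F - 1)"
    using 0 by simp
  with D have "translates_into F D \<noteq> {}"
    by (auto simp: lubell_def)
  then show ?case
    using contains_cube_Suc D(2) contains_cube_0 by metis
next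
  case (Suc t)
  let ?L = "lubell V F"
  have L0: "?L \<ge> 0"
    by (simp add: lubell_def sum_nonneg)
    \<comment> \<open>Otherwise \<open>L ^ 2 ^ (t + 1)\<close> would be at most \<open>4 ^ 2 ^ t\<close>, which does not exceed the assumed lower bound.\<close>
    have L2: "?L \<ge> 2"
    proof (rule ccontr)
      assume "\<not> ?L \<ge> 2"
      then have "?L ^ 2 ^ Suc t \<le> 2 ^ 2 ^ Suc t"
        using L0 by (intro power_mono) auto
      also have "(2 :: real) ^ 2 ^ Suc t \<le> 2 ^ (2 * (2 ^ Suc t - 1))"
      proof (rule power_increasing)
        have "(1 :: nat) \<le> 2 ^ t" by simp
        then show "(2 :: nat) ^ Suc t \<le> 2 * (2 ^ Suc t - 1)" by simp
      qed simp
      also have "\<dots> = 4 ^ (2 ^ Suc t - 1)"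
        by (simp add: power_mult)
      also have "\<dots> \<le> (4 * real M) ^ (2 ^ Suc t - 1)"
        using assms(1) by (intro power_mono) auto
      finally show False
        using Suc.prems(4) by simp
    qed
    obtain D where D: "D \<subseteq> V" "D \<noteq> {}"
      "?L * (?L - 1) \<le> 2 * real M * lubell (V - D) (translates_into F D)"
      using exists_dense_translates_into[of V M F] Suc.prems L2 by auto
    let ?K = "lubell (V - D) (translates_into F D)"
    have "?L * ?L \<le> ?L * (2 * (?L - 1))"
      using L2 by (intro mult_left_mono) auto
    then have sq: "?L\<^sup>2 \<le> 4 * real M * ?K"
      using D(3) by (simp add: power2_eq_square algebra_simps)
    have "(4 * real M) ^ (2 ^ t - 1) * (4 * real M) ^ 2 ^ t = (4 * real M) ^ (2 ^ Suc t - 1)"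
    proof -
      have "(1 :: nat) \<le> 2 ^ t" by simp
      then have "(2 ^ t - 1) + 2 ^ t = (2 ^ Suc t - 1 :: nat)" by simp
      then show ?thesis by (metis power_add)
    qed
    also have "\<dots> < (?L\<^sup>2) ^ 2 ^ t"
      using Suc.prems(4) by (simp flip: power_mult)
    also have "\<dots> \<le> (4 * real M * ?K) ^ 2 ^ t"
      using sq by (intro power_mono) auto
    also have "\<dots> = ?K ^ 2 ^ t * (4 * real M) ^ 2 ^ t"
      by (simp add: power_mult_distrib mult_ac)
    finally have "?K ^ 2 ^ t > (4 * real M) ^ (2 ^ t - 1)"
      by (rule mult_right_less_imp_less) simp
    moreover have "card (V - D) \<le> M"
      using Suc.prems(1,2) by (meson Diff_subset card_mono le_trans)
    moreover have "translates_into F D \<subseteq> Pow (V - D)"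
      using Suc.prems(3) by (auto simp: translates_into_def)
    ultimately have "contains_cube (Suc t) (translates_into F D)"
      using Suc.prems(1) by (intro Suc.IH) auto
    then show ?case
      using contains_cube_Suc D(2) by blast
qed

section \<open>A union bound over independent choices\<close>

text \<open>
  Choose the coordinates \<open>x i\<close> independently with the distributions \<open>w i\<close>. An event has probability at
  most \<open>\<delta>\<close> if, for one coordinate, its conditional probability is at most \<open>\<delta>\<close> whatever the other
  coordinates are; the coordinate may depend on the event. The union bound then leaves positive
  probability for avoiding all events.\<close>

lemma exists_choice_avoiding_rare_events:
  fixes w :: "'i \<Rightarrow> 'b \<Rightarrow> real"
  assumes K: "finite K" and Q: "finite Q"
    and fin: "\<And>i. i \<in> K \<Longrightarrow> finite (S i)"
    and nonneg: "\<And>i y. i \<in> K \<Longrightarrow> y \<in> S i \<Longrightarrow> 0 \<le> w i y"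
    and total: "\<And>i. i \<in> K \<Longrightarrow> (\<Sum>y\<in>S i. w i y) = 1"
    and rare: "\<And>q. q \<in> Q \<Longrightarrow>
      \<exists>i\<in>K. \<forall>g\<in>Pi\<^sub>E (K - {i}) S. (\<Sum>y\<in>{y \<in> S i. E q (g(i := y))}. w i y) \<le> \<delta>"
    and small: "real (card Q) * \<delta> < 1"
  shows "\<exists>x\<in>Pi\<^sub>E K S. \<forall>q\<in>Q. \<not> E q x"
proof (rule ccontr)
  assume "\<not> ?thesis"
  then have bad: "\<exists>q\<in>Q. E q x" if "x \<in> Pi\<^sub>E K S" for x
    using that by blast
  define W where "W = (\<lambda>K x. \<Prod>i\<in>K. w i (x i))"
  have W_nonneg: "0 \<le> W K' x" if "K' \<subseteq> K" "x \<in> Pi\<^sub>E K' S" for K' x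
    unfolding W_def using that nonneg by (intro prod_nonneg) (auto simp: PiE_iff)
  have W_total: "(\<Sum>x\<in>Pi\<^sub>E K' S. W K' x) = 1" if "K' \<subseteq> K" for K'
  proof -
    have "(\<Sum>x\<in>Pi\<^sub>E K' S. W K' x) = (\<Prod>i\<in>K'. \<Sum>y\<in>S i. w i y)"
      unfolding W_def using K fin that by (intro prod_sum_PiE[symmetric]) (auto intro: finite_subset)
    then show ?thesis
      using total that by (simp add: subset_iff)
  qed
  have event: "(\<Sum>x\<in>Pi\<^sub>E K S. of_bool (E q x) * W K x) \<le> \<delta>" if q: "q \<in> Q" for q
  proof -
    obtain i where i: "i \<in> K" and le:
      "\<And>g. g \<in> Pi\<^sub>E (K - {i}) S \<Longrightarrow> (\<Sum>y\<in>{y \<in> S i. E q (g(i := y))}. w i y) \<le> \<delta>"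
      using rare[OF q] by blast
    let ?K = "K - {i}"
    \<comment> \<open>Split off the coordinate \<open>i\<close>, so that the conditional bound applies to the inner sum.\<close>
    have W_upd: "W K (g(i := y)) = w i y * W ?K g" for g y
    proof -
      have "(\<Prod>j\<in>?K. w j ((g(i := y)) j)) = (\<Prod>j\<in>?K. w j (g j))"
        by (rule prod.cong) auto
      then show ?thesis
        unfolding W_def using prod.remove[OF K i, of "\<lambda>j. w j ((g(i := y)) j)"] by simp
    qed
    have "Pi\<^sub>E K S = (\<lambda>(y, g). g(i := y)) ` (S i \<times> Pi\<^sub>E ?K S)"
      using PiE_insert_eq[of i ?K S] i by (simp add: insert_absorb)
    then have "(\<Sum>x\<in>Pi\<^sub>E K S. of_bool (E q x) * W K x)
        = (\<Sum>(y, g)\<in>S i \<times> Pi\<^sub>E ?K S. of_bool (E q (g(i := y))) * (w i y * W ?K g))"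
      using inj_combinator[of i ?K S]
      by (simp add: sum.reindex W_upd case_prod_unfold o_def)
    also have "\<dots> = (\<Sum>g\<in>Pi\<^sub>E ?K S. \<Sum>y\<in>S i. of_bool (E q (g(i := y))) * (w i y * W ?K g))"
      by (subst sum.swap) (simp add: sum.cartesian_product)
    also have "\<dots> \<le> (\<Sum>g\<in>Pi\<^sub>E ?K S. \<delta> * W ?K g)"
    proof (rule sum_mono)
      fix g assume g: "g \<in> Pi\<^sub>E ?K S"
      have "(\<Sum>y\<in>S i. of_bool (E q (g(i := y))) * (w i y * W ?K g))
          = (\<Sum>y\<in>S i. of_bool (E q (g(i := y))) * w i y) * W ?K g"
        by (simp add: sum_distrib_right mult.assoc)
      also have "(\<Sum>y\<in>S i. of_bool (E q (g(i := y))) * w i y) = (\<Sum>y\<in>{y \<in> S i. E q (g(i := y))}. w i y)"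
        using fin[OF i] by (intro sum.mono_neutral_cong_right) auto
      also have "\<dots> * W ?K g \<le> \<delta> * W ?K g"
        using le[OF g] W_nonneg[OF _ g] by (intro mult_right_mono) auto
      finally show "(\<Sum>y\<in>S i. of_bool (E q (g(i := y))) * (w i y * W ?K g)) \<le> \<delta> * W ?K g" .
    qed
    also have "\<dots> = \<delta>"
      using W_total[of ?K] by (simp flip: sum_distrib_left)
    finally show ?thesis .
  qed
  have "1 = (\<Sum>x\<in>Pi\<^sub>E K S. W K x)"
    using W_total by simp
  also have "\<dots> \<le> (\<Sum>x\<in>Pi\<^sub>E K S. \<Sum>q\<in>Q. of_bool (E q x) * W K x)"
  proof (rule sum_mono)
    fix x assume x: "x \<in> Pi\<^sub>E K S"
    then obtain q where "q \<in> Q" "E q x" using bad by blast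
    then show "W K x \<le> (\<Sum>q\<in>Q. of_bool (E q x) * W K x)"
      using member_le_sum[of q Q "\<lambda>q. of_bool (E q x) * W K x"] Q W_nonneg[OF _ x] by simp
  qed
  also have "\<dots> = (\<Sum>q\<in>Q. \<Sum>x\<in>Pi\<^sub>E K S. of_bool (E q x) * W K x)"
    by (rule sum.swap)
  also have "\<dots> \<le> real (card Q) * \<delta>"
    using sum_mono[of Q _ "\<lambda>_. \<delta>", OF event] by simp
  finally show False using small by simp
qed

section \<open>Rainbow copies from sparse color classes\<close>

lemma boolean_algebra_copyI:
  assumes "\<And>i. i \<le> d \<Longrightarrow> X i \<subseteq> {1..n}" "disjoint_family_on X {0..d}"
    "\<And>i. i \<in> {1..d} \<Longrightarrow> X i \<noteq> {}"
  shows "boolean_algebra_copy n d {X 0 \<union> (\<Union>i\<in>I. X i) | I. I \<subseteq> {1..d}}"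
  unfolding boolean_algebra_copy_def using assms by (intro exI[of _ X]) auto

lemma monochromatic_copy_of_cube_over_base:
  assumes cube: "contains_cube s {A. A \<subseteq> V \<and> c (C \<union> A) = k}"
    and "C \<subseteq> {1..n}" "V \<subseteq> {1..n}" "C \<inter> V = {}"
  shows "\<exists>B. boolean_algebra_copy n s B \<and> monochromatic c B"
proof -
  obtain X where X: "disjoint_family_on X {0..s}" "\<forall>i\<in>{1..s}. X i \<noteq> {}"
    and mem: "\<forall>I\<subseteq>{1..s}. X 0 \<union> (\<Union>i\<in>I. X i) \<in> {A. A \<subseteq> V \<and> c (C \<union> A) = k}"
    using cube unfolding contains_cube_def by (elim exE conjE)
  have sub: "X 0 \<union> (\<Union>i\<in>I. X i) \<subseteq> V"
    and col: "c (C \<union> (X 0 \<union> (\<Union>i\<in>I. X i))) = k" if "I \<subseteq> {1..s}" for I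
    using mem[rule_format, OF that] by simp_all
  define Y where "Y = X(0 := C \<union> X 0)"
  have XV: "X i \<subseteq> V" if "i \<le> s" for i
    using sub[of "{1..s}"] that by (cases i) force+
  have Y_eq: "Y 0 \<union> (\<Union>i\<in>I. Y i) = C \<union> (X 0 \<union> (\<Union>i\<in>I. X i))" if "I \<subseteq> {1..s}" for I
  proof -
    have "(\<Union>i\<in>I. Y i) = (\<Union>i\<in>I. X i)"
      using that by (intro SUP_cong) (auto simp: Y_def)
    then show ?thesis by (simp add: Y_def Un_assoc)
  qed
  have "disjoint_family_on Y {0..s}"
    unfolding disjoint_family_on_def
  proof (intro ballI impI)
    fix m n assume "m \<in> {0..s}" "n \<in> {0..s}" "m \<noteq> n"
    then show "Y m \<inter> Y n = {}"
      using disjoint_family_onD[OF X(1), of m n] XV[of m] XV[of n] assms(4)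
      by (auto simp: Y_def)
  qed
  moreover have "Y i \<subseteq> {1..n}" if "i \<le> s" for i
    using XV[OF that] assms(2,3) by (auto simp: Y_def)
  moreover have "Y i \<noteq> {}" if "i \<in> {1..s}" for i
    using X(2) that by (simp add: Y_def)
  ultimately have "boolean_algebra_copy n s {Y 0 \<union> (\<Union>i\<in>I. Y i) | I. I \<subseteq> {1..s}}"
    by (intro boolean_algebra_copyI)
  moreover have "monochromatic c {Y 0 \<union> (\<Union>i\<in>I. Y i) | I. I \<subseteq> {1..s}}"
    unfolding monochromatic_def using col Y_eq by (intro exI[of _ k]) auto
  ultimately show ?thesis by blast
qed

text \<open>
  The exponent \<open>e\<close> satisfies \<open>4 * 2 ^ e = 2 ^ ((2 * r + 1) * 2 ^ t)\<close>. Hence the threshold of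
  \<open>lubell_large_imp_contains_cube\<close> with \<open>M = 2 ^ e\<close> is the \<open>2 ^ t\<close>-th power of the bound stated here.\<close>

lemma color_classes_on_blocks_are_sparse:
  assumes e: "e = (2 * r + 1) * 2 ^ t - 2" and r: "r \<ge> 1"
    and V: "finite V" "card V = 2 ^ e" "V \<subseteq> {1..n}" and C: "C \<subseteq> {1..n}" "C \<inter> V = {}"
    and no_mono: "\<nexists>B. boolean_algebra_copy n (Suc t) B \<and> monochromatic c B"
    and F: "F \<subseteq> {A. A \<subseteq> V \<and> c (C \<union> A) = k}"
  shows "lubell V F \<le> 2 ^ ((2 * r + 1) * (2 ^ t - 1))"
proof (rule ccontr)
  assume "\<not> ?thesis"
  then have large: "2 ^ ((2 * r + 1) * (2 ^ t - 1)) < lubell V F" by simp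
  have "(2 * r + 1) * 2 ^ t \<ge> 2 * 1"
    using r by (intro mult_mono) auto
  then have "e + 2 = (2 * r + 1) * 2 ^ t"
    using e by simp
  moreover have "4 * real (2 ^ e) = 2 ^ (e + 2)"
    by (simp add: power_add)
  ultimately have "4 * real (2 ^ e) = 2 ^ ((2 * r + 1) * 2 ^ t)"
    by simp
  then have "(4 * real (2 ^ e)) ^ (2 ^ t - 1) = (2 ^ ((2 * r + 1) * (2 ^ t - 1))) ^ 2 ^ t"
    by (simp only: power_mult[symmetric] mult_ac)
  also have "\<dots> < lubell V F ^ 2 ^ t"
    using large by (intro power_strict_mono) auto
  finally have "contains_cube (Suc t) F"
    using F V by (intro lubell_large_imp_contains_cube[of "2 ^ e" V]) auto
  then have "contains_cube (Suc t) {A. A \<subseteq> V \<and> c (C \<union> A) = k}"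
    using F by (rule contains_cube_mono)
  then show False
    using monochromatic_copy_of_cube_over_base[OF _ C(1) V(3) C(2)] no_mono by (elim notE)
qed

text \<open>
  Cut \<open>{1..n}\<close> into \<open>r\<close> blocks \<open>V i\<close> of size \<open>2 ^ e\<close>, let \<open>X\<^sub>0\<close> be empty, and choose each \<open>X\<^sub>i\<close> as a random
  non-empty subset of \<open>V i\<close> with probabilities proportional to \<open>1 / (card (V i) choose card X\<^sub>i)\<close>. Two
  index sets \<open>I \<noteq> J\<close> collide if their unions have the same color. For \<open>i \<in> I - J\<close>, once the other
  coordinates are fixed, the union over \<open>J\<close> has a fixed color, so the colliding choices of \<open>X\<^sub>i\<close> lie in
  a color class, and by sparseness they have probability at most \<open>2 ^ - (2 * r - 1)\<close>. This is less
  than the inverse of the number of pairs \<open>{I, J}\<close>, so some choice has no collision.\<close>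

lemma rainbow_copy_if_no_monochromatic_copy:
  fixes c :: "nat set \<Rightarrow> nat"
  assumes r: "r \<ge> 1" and e: "e = (2 * r + 1) * 2 ^ t - 2" and n: "n = r * 2 ^ e"
    and no_mono: "\<nexists>B. boolean_algebra_copy n (Suc t) B \<and> monochromatic c B"
  shows "\<exists>B. boolean_algebra_copy n r B \<and> rainbow c B"
proof -
  define m :: nat where "m = 2 ^ e"
  define V where "V = (\<lambda>i. {(i - 1) * m + 1..i * m})"
  define S where "S = (\<lambda>i. Pow (V i) - {{}})"
  define w where "w = (\<lambda>i (A :: nat set). 1 / (real m * real (card (V i) choose card A)))"
  define Q :: "nat set set set" where "Q = {q. q \<subseteq> Pow {1..r} \<and> card q = 2}"
  define \<delta> :: real where "\<delta> = 1 / 2 ^ (2 * r - 1)"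
  define E where "E = (\<lambda>(q :: nat set set) x. \<not> inj_on (\<lambda>I. c (\<Union>i\<in>I. x i)) q)"
  have m0: "m > 0" by (simp add: m_def)
  have cardV: "card (V i) = m" if "i \<in> {1..r}" for i
    using that by (cases i) (auto simp: V_def)
  have V_sub: "V i \<subseteq> {1..n}" if "i \<in> {1..r}" for i
  proof -
    have "i * m \<le> n"
      using that by (simp add: n m_def)
    then show ?thesis
      unfolding V_def by (intro subsetI) simp
  qed
  have V_disj: "V i \<inter> V j = {}" if "i \<in> {1..r}" "j \<in> {1..r}" "i \<noteq> j" for i j
  proof -
    have less: "V i \<inter> V j = {}" if "i < j" for i j
    proof -
      have "i * m \<le> (j - 1) * m"
        using that by (intro mult_le_mono1) simp
      then show ?thesis
        unfolding V_def by (intro equals0I) (simp only: Int_iff atLeastAtMost_iff, linarith)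
    qed
    show ?thesis
      using less[of i j] less[of j i] that(3) by (cases rule: linorder_cases[of i j]) auto
  qed
  have finV: "finite (V i)" for i by (simp add: V_def)
  have w_sum: "(\<Sum>A\<in>F. w i A) = lubell (V i) F / real m" for i F
    unfolding w_def lubell_def sum_divide_distrib
    by (intro sum.cong refl) (simp add: field_simps)

  have "\<exists>x\<in>Pi\<^sub>E {1..r} S. \<forall>q\<in>Q. \<not> E q x"
  proof (rule exists_choice_avoiding_rare_events[where w = w and \<delta> = \<delta>])
    show "finite Q" by (simp add: Q_def)
    show "(\<Sum>A\<in>S i. w i A) = 1" if "i \<in> {1..r}" for i
      using sum_inverse_binomial_nonempty_subsets[OF finV[of i]] cardV[OF that] m0
      by (simp add: w_sum lubell_def S_def)
    \<comment> \<open>There are \<open>2 ^ r * (2 ^ r - 1) / 2 < 2 ^ (2 * r - 1)\<close> unordered pairs of index sets.\<close>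
    have "card Q = 2 ^ r choose 2"
      unfolding Q_def by (subst n_subsets) (auto simp: card_Pow)
    moreover have "even (2 ^ r * (2 ^ r - 1) :: nat)"
      using r by simp
    ultimately have "2 * card Q = 2 ^ r * (2 ^ r - 1)"
      unfolding choose_two by (metis dvd_mult_div_cancel)
    then have "real (2 * card Q) = real (2 ^ r * (2 ^ r - 1))"
      by (simp only:)
    also have "\<dots> < 2 ^ r * 2 ^ r"
      by (simp add: of_nat_diff)
    also have "\<dots> = 2 ^ (2 * r)"
      by (simp add: mult_2 power_add)
    also have "\<dots> = 2 * 2 ^ (2 * r - 1)"
      using r by (simp flip: power_Suc)
    finally show "real (card Q) * \<delta> < 1"
      by (simp add: \<delta>_def)
    show "\<exists>i\<in>{1..r}. \<forall>g\<in>Pi\<^sub>E ({1..r} - {i}) S. (\<Sum>A\<in>{A \<in> S i. E q (g(i := A))}. w i A) \<le> \<delta>"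
      if q: "q \<in> Q" for q
    proof -
      obtain I\<^sub>1 I\<^sub>2 where pair: "q = {I\<^sub>1, I\<^sub>2}" "I\<^sub>1 \<noteq> I\<^sub>2"
        using q unfolding Q_def card_2_iff by blast
      have "I\<^sub>1 - I\<^sub>2 \<noteq> {} \<or> I\<^sub>2 - I\<^sub>1 \<noteq> {}"
        using pair(2) by blast
      then obtain I J where IJ: "q = {I, J}" "I - J \<noteq> {}"
        using pair(1) insert_commute[of I\<^sub>1 I\<^sub>2 "{}"] by metis
      then obtain i where i_IJ: "i \<in> I" "i \<notin> J" by blast
      have sub: "I \<subseteq> {1..r}" "J \<subseteq> {1..r}"
        using q unfolding Q_def IJ(1) by simp_all
      have neq: "I \<noteq> J" using i_IJ by blast
      have i: "i \<in> {1..r}" using i_IJ(1) sub(1) by blast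
      show ?thesis
      proof (intro bexI[OF _ i] ballI)
        fix g assume g: "g \<in> Pi\<^sub>E ({1..r} - {i}) S"
        let ?C = "\<Union>j\<in>I - {i}. g j" and ?k = "c (\<Union>j\<in>J. g j)"
        let ?F = "{A \<in> S i. E q (g(i := A))}"
        have gV: "g j \<subseteq> V j" if "j \<in> I - {i}" for j
          using g that sub(1) by (auto simp: PiE_iff S_def)
        have C1: "?C \<subseteq> {1..n}"
          using gV V_sub sub(1) by blast
        have C2: "?C \<inter> V i = {}"
          using gV V_disj[OF i] sub(1) by blast
        have F: "?F \<subseteq> {A. A \<subseteq> V i \<and> c (?C \<union> A) = ?k}"
        proof
          fix A assume A: "A \<in> ?F"
          have "(\<Union>j\<in>I. (g(i := A)) j) = ?C \<union> A"
            using i_IJ(1) by (auto split: if_splits)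
          moreover have "(\<Union>j\<in>J. (g(i := A)) j) = (\<Union>j\<in>J. g j)"
            using i_IJ(2) by (intro SUP_cong) auto
          ultimately show "A \<in> {A. A \<subseteq> V i \<and> c (?C \<union> A) = ?k}"
            using A neq by (auto simp: E_def IJ(1) S_def)
        qed
        have "card (V i) = 2 ^ e"
          using cardV[OF i] by (simp only: m_def)
        then have "lubell (V i) ?F \<le> 2 ^ ((2 * r + 1) * (2 ^ t - 1))"
          by (rule color_classes_on_blocks_are_sparse[OF e r finV _ V_sub[OF i] C1 C2 no_mono F])
        moreover have "\<delta> * real m = 2 ^ ((2 * r + 1) * (2 ^ t - 1))"
        proof -
          have "(2 * r + 1) * 2 ^ t = (2 * r + 1) * ((2 ^ t - 1) + 1)"
            by simp
          also have "\<dots> = (2 * r + 1) * (2 ^ t - 1) + (2 * r + 1)"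
            by (simp only: distrib_left mult_1_right)
          finally have "e = (2 * r + 1) * (2 ^ t - 1) + (2 * r + 1) - 2"
            by (simp only: e)
          also have "\<dots> = (2 * r + 1) * (2 ^ t - 1) + (2 * r - 1)"
            using r by linarith
          finally show ?thesis
            unfolding \<delta>_def m_def by (simp only: power_add of_nat_power of_nat_numeral) simp
        qed
        ultimately show "(\<Sum>A\<in>?F. w i A) \<le> \<delta>"
          using m0 by (simp add: w_sum divide_le_eq)
      qed
    qed
  qed (auto simp: S_def finV w_def)
  then obtain x where x: "x \<in> Pi\<^sub>E {1..r} S" and good: "\<And>q. q \<in> Q \<Longrightarrow> \<not> E q x"
    by blast
  define X where "X = x(0 := {})"
  have xS: "x i \<subseteq> V i" "x i \<noteq> {}" if "i \<in> {1..r}" for i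
    using x that by (auto simp: PiE_iff S_def)
  have X_eq: "X 0 \<union> (\<Union>i\<in>I. X i) = (\<Union>i\<in>I. x i)" if "I \<subseteq> {1..r}" for I
  proof -
    have "(\<Union>i\<in>I. X i) = (\<Union>i\<in>I. x i)"
      using that by (intro SUP_cong) (auto simp: X_def)
    then show ?thesis by (simp add: X_def)
  qed
  have "boolean_algebra_copy n r {X 0 \<union> (\<Union>i\<in>I. X i) | I. I \<subseteq> {1..r}}"
  proof (rule boolean_algebra_copyI)
    show "X i \<subseteq> {1..n}" if "i \<le> r" for i
      using xS(1)[of i] V_sub[of i] that by (cases "i = 0") (auto simp: X_def)
    show "X i \<noteq> {}" if "i \<in> {1..r}" for i
      using xS(2)[OF that] that by (simp add: X_def)
    show "disjoint_family_on X {0..r}"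
      unfolding disjoint_family_on_def
    proof (intro ballI impI)
      fix i j assume "i \<in> {0..r}" "j \<in> {0..r}" "i \<noteq> j"
      then show "X i \<inter> X j = {}"
        using xS(1)[of i] xS(1)[of j] V_disj[of i j]
        by (cases "i = 0"; cases "j = 0") (auto simp: X_def)
    qed
  qed
  moreover have "rainbow c {X 0 \<union> (\<Union>i\<in>I. X i) | I. I \<subseteq> {1..r}}"
    unfolding rainbow_def
  proof (rule inj_onI)
    fix A B assume "A \<in> {X 0 \<union> (\<Union>i\<in>I. X i) | I. I \<subseteq> {1..r}}" "B \<in> {X 0 \<union> (\<Union>i\<in>I. X i) | I. I \<subseteq> {1..r}}"
      and eq: "c A = c B"
    then obtain I J where I: "I \<subseteq> {1..r}" "A = (\<Union>i\<in>I. x i)" and J: "J \<subseteq> {1..r}" "B = (\<Union>i\<in>J. x i)"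
      using X_eq by auto
    show "A = B"
    proof (rule ccontr)
      assume "A \<noteq> B"
      then have "I \<noteq> J" using I J by auto
      then have "{I, J} \<in> Q" using I J by (auto simp: Q_def)
      then show False
        using good[of "{I, J}"] eq I J \<open>I \<noteq> J\<close> by (auto simp: E_def)
    qed
  qed
  ultimately show ?thesis
    by (intro exI conjI)
qed

theorem theorem5:
  fixes r s :: nat
  assumes "r \<ge> 1" and "s \<ge> 1"
  shows "CR r s \<le> enat (r * 2 ^ ((2 * r + 1) * 2 ^ (s - 1) - 2))"
proof -
  have "CR_property r s (r * 2 ^ ((2 * r + 1) * 2 ^ (s - 1) - 2))"
    unfolding CR_property_def
  proof (intro allI)
    fix c :: "nat set \<Rightarrow> nat"
    have "Suc (s - 1) = s" using assms(2) by simp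
    then show "(\<exists>B. boolean_algebra_copy (r * 2 ^ ((2 * r + 1) * 2 ^ (s - 1) - 2)) r B \<and> rainbow c B) \<or>
        (\<exists>B. boolean_algebra_copy (r * 2 ^ ((2 * r + 1) * 2 ^ (s - 1) - 2)) s B \<and> monochromatic c B)"
      using rainbow_copy_if_no_monochromatic_copy[OF assms(1) refl refl, of "s - 1" c] by metis
  qed
  then show ?thesis
    unfolding CR_def by (intro Inf_lower) blast
qed

end
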